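(* Let $X$ be a compact metric space, let $\mu\in\mathcal{P}(X)$ be a probability measure on $X$, and let $x_1,\dots,x_N$ be $N$ i.i.d. samples from $\mu$. Let $n\in\mathbb{N}$ and assume $\mathrm{mod}(N,n)=0$, i.e., it is possible to split the observed samples into $n$ subsets of size $N/n$. Let $\mathcal{X}_n$ denote the set of all partitions $\{C_i\}_{i=1}^n$ of $X$ into $n$ subsets, and for such a partition let $N_i:=|\{x_k\in C_i\}|$ be the number of samples in the $i$-th cell, which is assumed to be positive for each $1\le i\le n$. Then a partition $\{\hat C_i\}\in\mathcal{X}_n$ satisfies $$\{\hat C_i\}\in\operatorname*{arg\,min}_{\{C_i\}\in\mathcal{X}_n}\ \max_{1\le i\le n}\frac{1}{\sqrt{N_i}}$$ if and only if $N_i=N/n$ for all $1\le i\le n$, where here $N_i$ is the number of samples in $\hat C_i$.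
   Context: A partition of $X$ into $n$ subsets is a family $\{C_i\}_{i=1}^n$ of pairwise disjoint subsets of $X$ whose union is $X$. The counts $N_i$ depend on the partition, and the minimization is over partitions for the given observed samples. The minimax condition is called the principle of optimal variance reduction (V2). It comes from estimating the transition probabilities $M_{i,j}=\mu(C_i\cap T^{-1}(C_j))/\mu(C_i)$ of a map $T:X\to X$ by the fraction of the $N_i$ samples in $C_i$ that $T$ sends into $C_j$. The standard deviation of this estimate is $\sqrt{(M_{i,j}-M_{i,j}^2)/N_i}$, and $M_{i,j}-M_{i,j}^2\in[0,1/4]$.
   Formalization: Besides mod(N,n)=0, the samples are assumed pairwise distinct or such that the observed points can be split into n subsets with N/n samples each (counted with multiplicity); with ties, mod(N,n)=0 alone is not enough: for a,a,a,b and n=2 no even partition exists. *)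

theory Defs
  imports "HOL-Probability.Probability"
begin

text \<open>A partition is an indexed family \<open>C 1, \<dots>, C n\<close>; the values of \<open>C\<close> outside \<open>{1..n}\<close> are
  irrelevant. The cells are arbitrary subsets: neither measurability nor nonemptiness is imposed.\<close>

definition partitions_into :: "'a set \<Rightarrow> nat \<Rightarrow> (nat \<Rightarrow> 'a set) set" where
  "partitions_into X n = {C. disjoint_family_on C {1..n} \<and> (\<Union>i\<in>{1..n}. C i) = X}"

text \<open>Samples are counted by their index \<open>k\<close>, hence with multiplicity when values repeat.\<close>

definition sample_count :: "(nat \<Rightarrow> 'a) \<Rightarrow> nat \<Rightarrow> 'a set \<Rightarrow> nat" where
  "sample_count x N A = card {k \<in> {1..N}. x k \<in> A}"

definition admissible_partitions ::
    "'a set \<Rightarrow> nat \<Rightarrow> (nat \<Rightarrow> 'a) \<Rightarrow> nat \<Rightarrow> (nat \<Rightarrow> 'a set) set" where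
  "admissible_partitions X n x N =
     {C \<in> partitions_into X n. \<forall>i\<in>{1..n}. sample_count x N (C i) > 0}"

definition max_deviation :: "(nat \<Rightarrow> 'a) \<Rightarrow> nat \<Rightarrow> nat \<Rightarrow> (nat \<Rightarrow> 'a set) \<Rightarrow> real" where
  "max_deviation x N n C = Max ((\<lambda>i. 1 / sqrt (real (sample_count x N (C i)))) ` {1..n})"

text \<open>The observed samples can be split into \<open>n\<close> groups of size \<open>N / n\<close>. Samples with equal values
  lie in the same cell of every partition of the space, so the groups are sets of observed points.
  For pairwise distinct samples this amounts to \<open>n\<close> dividing \<open>N\<close>; with ties it may fail: the
  samples \<open>a, a, a, b\<close> cannot be split into two groups of two.\<close>

definition splits_evenly :: "(nat \<Rightarrow> 'a) \<Rightarrow> nat \<Rightarrow> nat \<Rightarrow> bool" where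
  "splits_evenly x N n \<longleftrightarrow>
     (\<exists>S \<in> partitions_into (x ` {1..N}) n. \<forall>i\<in>{1..n}. sample_count x N (S i) = N div n)"

end

theory Submission
  imports Defs
begin

text \<open>Since the counts add up to \<open>N\<close>, all of them are at least \<open>N / n\<close> only if all of them equal
  \<open>N / n\<close>. So the objective is at most \<open>1 / sqrt (N / n)\<close> exactly at the even partitions, which are
  therefore the minimizers as soon as one of them exists.\<close>

text \<open>Every sample lies in \<open>X\<close>, hence in exactly one cell, so the index sets of
  the cells partition \<open>{1..N}\<close>. Counting indices rather than values makes this hold for
  repeated samples too.\<close>

lemma sum_sample_count_partition:
  assumes "C \<in> partitions_into X n" "x ` {1..N} \<subseteq> X"
  shows "(\<Sum>i\<in>{1..n}. sample_count x N (C i)) = N"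
proof -
  have disj: "disjoint_family_on C {1..n}" and un: "(\<Union>i\<in>{1..n}. C i) = X"
    using assms(1) by (auto simp: partitions_into_def)
  have "(\<Sum>i\<in>{1..n}. sample_count x N (C i)) = card (\<Union>i\<in>{1..n}. {k \<in> {1..N}. x k \<in> C i})"
    unfolding sample_count_def
    by (rule card_UN_disjoint[symmetric])
      (use disj in \<open>auto simp: disjoint_family_on_def\<close>)
  also have "(\<Union>i\<in>{1..n}. {k \<in> {1..N}. x k \<in> C i}) = {1..N}"
    using assms(2) un by blast
  finally show ?thesis by simp
qed

lemma max_deviation_even:
  assumes "n \<ge> 1" "\<forall>i\<in>{1..n}. sample_count x N (C i) = m"
  shows "max_deviation x N n C = 1 / sqrt (real m)"
proof -
  have "(\<lambda>i. 1 / sqrt (real (sample_count x N (C i)))) ` {1..n} = {1 / sqrt (real m)}"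
    using assms by force
  then show ?thesis by (simp add: max_deviation_def)
qed

lemma max_deviation_le_imp_even:
  assumes C: "C \<in> admissible_partitions X n x N"
    and x: "x ` {1..N} \<subseteq> X" and N: "N = n * m" and "m > 0"
    and le: "max_deviation x N n C \<le> 1 / sqrt (real m)"
  shows "\<forall>i\<in>{1..n}. sample_count x N (C i) = m"
proof -
  have ge: "m \<le> sample_count x N (C i)" if i: "i \<in> {1..n}" for i
  proof -
    \<comment> \<open>In HOL \<open>1 / sqrt 0 = 0\<close>, so a cell without samples would meet the
      bound below; admissibility excludes it, and only then can the inequality be inverted.\<close>
    have pos: "sample_count x N (C i) > 0"
      using C i by (auto simp: admissible_partitions_def)
    have "1 / sqrt (real (sample_count x N (C i))) \<le> max_deviation x N n C"
      unfolding max_deviation_def using i by (intro Max_ge) auto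
    with le have "1 / sqrt (real (sample_count x N (C i))) \<le> 1 / sqrt (real m)"
      by simp
    then show ?thesis
      using pos \<open>m > 0\<close> by (simp add: field_simps)
  qed
  \<comment> \<open>Both sums equal \<open>N\<close>, so no termwise inequality
    \<open>m \<le> sample_count x N (C i)\<close> can be strict.\<close>
  have "(\<Sum>i\<in>{1..n}. m) = (\<Sum>i\<in>{1..n}. sample_count x N (C i))"
    using sum_sample_count_partition[OF _ x] C N by (simp add: admissible_partitions_def)
  then show ?thesis
    using sum_mono_inv[of "\<lambda>_. m" "{1..n}" "\<lambda>i. sample_count x N (C i)"] ge by auto
qed

text \<open>The index range is cut into \<open>n\<close> consecutive blocks of length
  \<open>m\<close>, and the groups are the images of the blocks. Injectivity carries disjointness
  and size over from indices to values.\<close>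

lemma splits_evenly_inj:
  assumes inj: "inj_on x {1..N}" and N: "N = n * m" and "m > 0" "n > 0"
  shows "splits_evenly x N n"
proof -
  define B where "B i = {(i - 1) * m<..i * m}" for i
  have B_sub: "B i \<subseteq> {1..N}" if "i \<in> {1..n}" for i
    using that N by (auto simp: B_def intro: order_trans[OF _ mult_le_mono1])
  have B_disj: "B i \<inter> B j = {}" if "i < j" for i j
    using that by (auto simp: B_def Ioc_disjoint)
  have B_cover: "\<exists>i\<in>{1..n}. k \<in> B i" if k: "k \<in> {1..N}" for k
  proof -
    \<comment> \<open>Blocks are open on the left and closed on the right, so \<open>k - 1\<close>
      is the zero-based position of \<open>k\<close> and \<open>q\<close> its zero-based block
      number; the blocks themselves are numbered from 1.\<close>
    define q where "q = (k - 1) div m"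
    have "q < n"
      using k N \<open>m > 0\<close> by (auto simp: q_def less_mult_imp_div_less)
    moreover have "q * m \<le> k - 1" "k - 1 < Suc q * m"
      using \<open>m > 0\<close> by (auto simp: q_def dividend_less_div_times)
    ultimately have "Suc q \<in> {1..n}" "k \<in> B (Suc q)"
      using k by (auto simp: B_def)
    then show ?thesis by blast
  qed
  have count: "sample_count x N (x ` B i) = m" if i: "i \<in> {1..n}" for i
  proof -
    \<comment> \<open>By injectivity no index outside the block shares a value with one inside
      it.\<close>
    have "{k \<in> {1..N}. x k \<in> x ` B i} = B i"
      using B_sub[OF i] inj_on_image_mem_iff[OF inj _ B_sub[OF i]] by blast
    moreover have "i * m - (i - 1) * m = m"
      using i by (simp add: diff_mult_distrib[symmetric])
    ultimately show ?thesis by (simp add: sample_count_def B_def)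
  qed
  have disj: "disjoint_family_on (\<lambda>i. x ` B i) {1..n}"
  proof (unfold disjoint_family_on_def, intro ballI impI)
    fix i j assume i: "i \<in> {1..n}" and j: "j \<in> {1..n}" and "i \<noteq> j"
    then have "B i \<inter> B j = {}"
      using B_disj[of i j] B_disj[of j i] by (auto simp: neq_iff)
    then show "x ` B i \<inter> x ` B j = {}"
      using inj_on_image_Int[OF inj B_sub[OF i] B_sub[OF j]] by simp
  qed
  have un: "(\<Union>i\<in>{1..n}. x ` B i) = x ` {1..N}"
    using B_sub B_cover by blast
  have "N div n = m" using N \<open>n > 0\<close> by simp
  then show ?thesis
    unfolding splits_evenly_def partitions_into_def using disj un count
    by (intro bexI[of _ "\<lambda>i. x ` B i"]) auto
qed

text \<open>The given groups cover only the observed points. All other points of \<open>X\<close>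
  are put into the first cell, which exists since \<open>n \<ge> 1\<close>; they contain no sample,
  so no count changes.\<close>

lemma splits_evenly_imp_even_partition:
  assumes "splits_evenly x N n" "x ` {1..N} \<subseteq> X" "n \<ge> 1"
  obtains D where "D \<in> partitions_into X n"
    "\<forall>i\<in>{1..n}. sample_count x N (D i) = N div n"
proof -
  obtain S where disj: "disjoint_family_on S {1..n}" and un: "(\<Union>i\<in>{1..n}. S i) = x ` {1..N}"
    and count: "\<forall>i\<in>{1..n}. sample_count x N (S i) = N div n"
    using assms(1) by (auto simp: splits_evenly_def partitions_into_def)
  define D where "D i = (if i = 1 then S i \<union> (X - x ` {1..N}) else S i)" for i :: nat
  have sub: "S i \<subseteq> x ` {1..N}" if "i \<in> {1..n}" for i
    using un that by blast
  have "disjoint_family_on D {1..n}"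
    unfolding disjoint_family_on_def
  proof (intro ballI impI)
    fix i j assume i: "i \<in> {1..n}" and j: "j \<in> {1..n}" and ne: "i \<noteq> j"
    have "S i \<inter> S j = {}"
      using disjoint_family_onD[OF disj i j ne] .
    \<comment> \<open>At most one of the two cells received the unobserved points, and the other one
      consists of observed points.\<close>
    then show "D i \<inter> D j = {}"
      using sub[OF i] sub[OF j] ne by (auto simp: D_def)
  qed
  moreover have "(\<Union>i\<in>{1..n}. D i) = (\<Union>i\<in>{1..n}. S i) \<union> (X - x ` {1..N})"
    using \<open>n \<ge> 1\<close> by (auto simp: D_def split: if_splits)
  then have "(\<Union>i\<in>{1..n}. D i) = X"
    using assms(2) un by auto
  moreover have "{k \<in> {1..N}. x k \<in> D i} = {k \<in> {1..N}. x k \<in> S i}" for i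
    by (auto simp: D_def)
  then have "\<forall>i\<in>{1..n}. sample_count x N (D i) = N div n"
    using count by (simp add: sample_count_def)
  ultimately show ?thesis
    by (intro that[of D]) (simp_all add: partitions_into_def)
qed

theorem proposition4p9:
  fixes X :: "'a :: metric_space set"
    and \<mu> :: "'a measure"
    and P :: "'w measure"
    and \<xi> :: "nat \<Rightarrow> 'w \<Rightarrow> 'a"
    and N n :: nat
    and \<omega> :: 'w
    and C :: "nat \<Rightarrow> 'a set"
  assumes "compact X"
    and "prob_space \<mu>" and "sets \<mu> = sets (restrict_space borel X)"
    and "prob_space P"
    and "prob_space.indep_vars P (\<lambda>_. \<mu>) \<xi> {1..N}"
    and "\<forall>k\<in>{1..N}. distr P \<mu> (\<xi> k) = \<mu>"
    and "N \<ge> 1" and "n \<ge> 1" and "N mod n = 0"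
    and "\<omega> \<in> space P"
    and "inj_on (\<lambda>k. \<xi> k \<omega>) {1..N} \<or> splits_evenly (\<lambda>k. \<xi> k \<omega>) N n"
    and "C \<in> partitions_into X n"
  shows "is_arg_min (max_deviation (\<lambda>k. \<xi> k \<omega>) N n)
             (\<lambda>D. D \<in> admissible_partitions X n (\<lambda>k. \<xi> k \<omega>) N) C
         \<longleftrightarrow> (\<forall>i\<in>{1..n}. real (sample_count (\<lambda>k. \<xi> k \<omega>) N (C i)) = real N / real n)"
proof -
  interpret P: prob_space P by fact
  define x where "x k = \<xi> k \<omega>" for k
  define m where "m = N div n"
  have N: "N = n * m" using \<open>N mod n = 0\<close> by (auto simp: m_def)
  then have m: "m > 0" using \<open>N \<ge> 1\<close> by (cases m) auto
  have even_iff: "real k = real N / real n \<longleftrightarrow> k = m" for k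
    using N \<open>n \<ge> 1\<close> by simp
  \<comment> \<open>Independence includes measurability of each \<open>\<xi> k\<close> into
    \<open>\<mu>\<close>, whose space is \<open>X\<close>; hence the realised samples at
    \<open>\<omega>\<close> lie in \<open>X\<close>.\<close>
  have "space \<mu> = X"
    using sets_eq_imp_space_eq[OF assms(3)] by (simp add: space_restrict_space)
  moreover have "\<xi> k \<in> P \<rightarrow>\<^sub>M \<mu>" if "k \<in> {1..N}" for k
    using assms(5) that by (auto simp: P.indep_vars_def)
  ultimately have x: "x ` {1..N} \<subseteq> X"
    using measurable_space[OF _ \<open>\<omega> \<in> space P\<close>] unfolding x_def by blast
  have "splits_evenly x N n"
    using assms(11) splits_evenly_inj[OF _ N m] \<open>n \<ge> 1\<close> by (auto simp: x_def[abs_def])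
  then obtain D where D: "D \<in> partitions_into X n"
    and D_even: "\<forall>i\<in>{1..n}. sample_count x N (D i) = m"
    using splits_evenly_imp_even_partition x \<open>n \<ge> 1\<close> unfolding m_def by blast
  \<comment> \<open>Even partitions have positive counts because \<open>m > 0\<close>, so they
    compete in the minimization.\<close>
  have adm: "E \<in> admissible_partitions X n x N"
    if "E \<in> partitions_into X n" "\<forall>i\<in>{1..n}. sample_count x N (E i) = m" for E
    using that m by (simp add: admissible_partitions_def)
  note le_imp_even = max_deviation_le_imp_even[OF _ x N m]
  note even_value = max_deviation_even[OF \<open>n \<ge> 1\<close>]
  have "is_arg_min (max_deviation x N n) (\<lambda>D. D \<in> admissible_partitions X n x N) C
      \<longleftrightarrow> (\<forall>i\<in>{1..n}. sample_count x N (C i) = m)" (is "?min \<longleftrightarrow> ?even")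
  proof
    assume ?min
    \<comment> \<open>The even competitor \<open>D\<close> has value \<open>1 / sqrt m\<close>,
      which bounds the value of a minimizer.\<close>
    then have "C \<in> admissible_partitions X n x N" "max_deviation x N n C \<le> max_deviation x N n D"
      using adm[OF D D_even] by (auto simp: is_arg_min_linorder)
    then show ?even
      using le_imp_even even_value[OF D_even] by simp
  next
    assume ev: ?even
    \<comment> \<open>If \<open>E\<close> had a smaller value than \<open>C\<close>, that value
      would be below \<open>1 / sqrt m\<close>; then \<open>E\<close> would be even and have the
      same value as \<open>C\<close>, a contradiction.\<close>
    have "max_deviation x N n C \<le> max_deviation x N n E"
      if "E \<in> admissible_partitions X n x N" for E
      using le_imp_even[OF that] even_value[OF ev] even_value[of x N E m] by linarith
    then show ?min
      using adm[OF \<open>C \<in> partitions_into X n\<close> ev] by (simp add: is_arg_min_linorder)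
  qed
  then show ?thesis
    by (simp add: even_iff x_def[abs_def])
qed

end
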